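(* Throughout, $D$ denotes a linear code of the indicated blocklength $n$. (1) Let $n=3k-1$ with $k\ge1$. If $D$ is not equivalent to $C(k,k,k-1)$, then $C(k,k,k-1)$ is universally strictly better than $D$. (2) Let $n=3$, and let $C_A$ be the code with columns of types $3,5,0$ in this order. If $D$ is equivalent to none of $C_A$, $C(1,1,1)$, $C(1,2,0)$, then each of $C_A$, $C(1,1,1)$, $C(1,2,0)$ is universally strictly better than $D$. (3) Let $n=3k$ with $k\ge2$. If $D$ is equivalent to neither $C(k+1,k+1,k-2)$ nor $C(k+1,k,k-1)$, then each of $C(k+1,k+1,k-2)$ and $C(k+1,k,k-1)$ is universally strictly better than $D$. (4) Let $n=3k+1$ with $k\ge1$. If $D$ is equivalent to neither $C(k+1,k,k)$ nor $C(k+2,k,k-1)$, then each of $C(k+1,k,k)$ and $C(k+2,k,k-1)$ is universally strictly better than $D$.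
   Context: A code of blocklength $n$ (an "$(n,4)$ code") is here an arbitrary $4\times n$ binary matrix $C$ (repeated rows are allowed), with rows (codewords) $r_0,r_1,r_2,r_3\in\{0,1\}^n$ and $n$ columns in $\{0,1\}^4$. For $y\in\{0,1\}^n$ let $d_C(y)=\min_{0\le j\le 3} d_H(r_j,y)$, where $d_H$ is Hamming distance, and $$\lambda_C(\varepsilon)=\tfrac14\sum_{y\in\{0,1\}^n}(1-\varepsilon)^{n-d_C(y)}\varepsilon^{d_C(y)}.$$ For codes $C,D$ of the same blocklength, $C$ is universally strictly better than $D$ if $\lambda_C(\varepsilon)>\lambda_D(\varepsilon)$ for all $0<\varepsilon<1/2$. Two codes are equivalent if one is obtained from the other by a permutation of the rows, a permutation of the columns, and flipping all four bits in some subset of the columns. The type of a column $(b_0,b_1,b_2,b_3)^T$ ($b_j$ the entry in row $j$) is the integer $8b_0+4b_1+2b_2+b_3\in\{0,\dots,15\}$. $|i|_C$ denotes the number of columns of $C$ of type $i$. Linear: $C$ is linear if every column has type in $\{0,3,5,6\}$ and at least two of $|3|_C,|5|_C,|6|_C$ are positive. For nonnegative integers $n_3,n_5,n_6$, $C(n_3,n_5,n_6)$ denotes the canonical code of blocklength $n_3+n_5+n_6$ having $n_3$ columns of type 3, followed by $n_5$ columns of type 5, followed by $n_6$ columns of type 6. *)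

theory Defs
  imports Complex_Main "HOL-Library.Numeral_Type" "HOL-Combinatorics.Permutations"
begin

text \<open>
  A \<open>4 \<times> n\<close> binary matrix is represented as the list of its \<open>n\<close> columns. The rows are indexed by
  the four-element type \<open>4\<close> with elements 0, 1, 2, 3 (in this type \<open>4 = 0\<close>).
\<close>

type_synonym column = "4 \<Rightarrow> bool"
type_synonym code = "column list"

definition row :: "code \<Rightarrow> 4 \<Rightarrow> bool list" where
  "row C j = map (\<lambda>c. c j) C"

text \<open>Only used for words of the same length.\<close>

definition hamming_dist :: "bool list \<Rightarrow> bool list \<Rightarrow> nat" where
  "hamming_dist x y = card {i. i < length x \<and> x ! i \<noteq> y ! i}"

definition code_dist :: "code \<Rightarrow> bool list \<Rightarrow> nat" where
  "code_dist C y = Min (range (\<lambda>j. hamming_dist (row C j) y))"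

definition success_prob :: "code \<Rightarrow> real \<Rightarrow> real" where
  "success_prob C \<epsilon> =
     1 / 4 * (\<Sum>y | length y = length C.
       (1 - \<epsilon>) ^ (length C - code_dist C y) * \<epsilon> ^ code_dist C y)"

definition univ_strictly_better :: "code \<Rightarrow> code \<Rightarrow> bool" where
  "univ_strictly_better C D \<longleftrightarrow>
     length C = length D \<and>
     (\<forall>\<epsilon>. 0 < \<epsilon> \<and> \<epsilon> < 1 / 2 \<longrightarrow> success_prob C \<epsilon> > success_prob D \<epsilon>)"

text \<open>
  Here \<open>p\<close> permutes the rows, \<open>s\<close> permutes the columns, and \<open>F\<close> is the set of (positions of)
  columns that are flipped; the inequality of truth values is exclusive or.
\<close>

definition equivalent_codes :: "code \<Rightarrow> code \<Rightarrow> bool" where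
  "equivalent_codes C D \<longleftrightarrow>
     length C = length D \<and>
     (\<exists>p s F. bij p \<and> s permutes {..<length C} \<and> F \<subseteq> {..<length C} \<and>
        (\<forall>i<length C. \<forall>j. (D ! i) j = ((C ! s i) (p j) \<noteq> (i \<in> F))))"

definition column_type :: "column \<Rightarrow> nat" where
  "column_type c = 8 * of_bool (c 0) + 4 * of_bool (c 1) + 2 * of_bool (c 2) + of_bool (c 3)"

definition num_cols :: "nat \<Rightarrow> code \<Rightarrow> nat" where
  "num_cols t C = length (filter (\<lambda>c. column_type c = t) C)"

definition linear_code :: "code \<Rightarrow> bool" where
  "linear_code C \<longleftrightarrow>
     (\<forall>c \<in> set C. column_type c \<in> {0, 3, 5, 6}) \<and>
     2 \<le> card {t \<in> {3, 5, 6}. 0 < num_cols t C}"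

definition column_of_type :: "nat \<Rightarrow> column" where
  "column_of_type t =
     (\<lambda>j. if j = 0 then bit t 3 else if j = 1 then bit t 2 else if j = 2 then bit t 1 else bit t 0)"

definition canonical_code :: "nat \<Rightarrow> nat \<Rightarrow> nat \<Rightarrow> code" where
  "canonical_code n3 n5 n6 =
     replicate n3 (column_of_type 3) @ replicate n5 (column_of_type 5) @
     replicate n6 (column_of_type 6)"

definition code_A :: code where
  "code_A = map column_of_type [3, 5, 0]"

lemma column_type_of_type:
  assumes "t < 16"
  shows "column_type (column_of_type t) = t"
proof -
  have "t = 0 \<or> t = 1 \<or> t = 2 \<or> t = 3 \<or> t = 4 \<or> t = 5 \<or> t = 6 \<or> t = 7 \<or>
    t = 8 \<or> t = 9 \<or> t = 10 \<or> t = 11 \<or> t = 12 \<or> t = 13 \<or> t = 14 \<or> t = 15"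
    using assms by (simp add: eval_nat_numeral less_Suc_eq)
  then show ?thesis
    by (elim disjE) (simp_all add: column_type_def column_of_type_def bit_0)
qed

lemma length_canonical_code: "length (canonical_code n3 n5 n6) = n3 + n5 + n6"
  by (simp add: canonical_code_def)

end

theory Submission
  imports Defs
begin

text \<open>
  A linear code is determined, up to the order of its columns, by its profile: the numbers \<open>a\<close>, \<open>b\<close>, \<open>c\<close>
  of columns of types 3, 5, 6, together with the number of zero columns. Put \<open>q = \<epsilon> / (1 - \<epsilon>)\<close>, so that
  \<open>0 < q < 1\<close> and \<open>1 - \<epsilon> = 1 / (1 + q)\<close>. A zero column multiplies the sum of \<open>q ^ d(y)\<close> over all words \<open>y\<close>
  by \<open>1 + q\<close>, which the normalisation \<open>(1 - \<epsilon>) ^ n\<close> cancels. Hence \<open>4 \<lambda>(\<epsilon>)\<close> is a function of \<open>a\<close>, \<open>b\<close>, \<open>c\<close>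
  alone (\<open>profile_value\<close>), and it is symmetric because row permutations permute the types 3, 5, 6.

  Adding a column of type 3 separates rows 0, 1 from rows 2, 3 and helps exactly for those words that
  are equally far from both pairs. Comparing this with a column of type 5, most ties cancel, and what
  remains are the words whose set of nearest codewords is a single pair. By translation
  by codewords this leaves one sum for each of the two columns (\<open>pair_tie_sum\<close>), and
  \<open>distance_enumerator_diff\<close> says that the profile \<open>(a + 1, b, c)\<close> minus the profile \<open>(a, b + 1, c)\<close> has
  the sign of \<open>pair_tie_sum q b a c - pair_tie_sum q a b c\<close>. Distances to two codewords that differ in
  \<open>m\<close> places have a sum congruent to \<open>m\<close> modulo 2, so \<open>pair_tie_sum q a b c\<close> vanishes
  if \<open>b + c\<close> is odd. If \<open>b + c\<close> is even, it is positive except for very small \<open>a\<close>. Only when \<open>a\<close>, \<open>b\<close>, \<open>c\<close>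
  have the same parity can there be two positive sums to compare. For \<open>a < b\<close> the sum \<open>pair_tie_sum q b a c\<close>
  is larger: a shift by \<open>(b - a) / 2\<close> matches the two sums power by power, and the matched coefficients
  are compared by \<open>binomial_widening\<close>.

  These comparisons decide everything. If \<open>a\<close>, \<open>b\<close>, \<open>c\<close> have the same parity, moving a column from a
  large type to any other type is an improvement. Otherwise exactly one of them, say \<open>c\<close>, has a parity
  different from the other two, and \<open>(a, b, c + 1)\<close> is a triple of equal parities with sum \<open>n + 1\<close>.
  Decreasing any entry of that triple by one gives the same value, and changing two of its entries
  \<open>x + 4 \<le> z\<close> into \<open>x + 2\<close>, \<open>z - 2\<close> increases the value. So for an optimal profile the entries of the triple
  differ by at most 2, which leaves a single triple up to order for each \<open>n\<close>: \<open>(k, k, k)\<close>,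
  \<open>(k + 1, k + 1, k - 1)\<close> and \<open>(k + 2, k, k)\<close> for \<open>n = 3k - 1\<close>, \<open>3k\<close> and \<open>3k + 1\<close>.
  Decreasing an entry gives the codes of the theorem. Zero columns are treated by monotonicity, since
  replacing a zero column never decreases the value. Blocklength 3 is different: every linear code of that
  length is equivalent to one of the three listed codes.
\<close>

section \<open>Binomially weighted sums\<close>

text \<open>
  Sums over all words of length \<open>n\<close> of a function of the numbers of ones and zeros. Passing both numbers
  to the summand keeps truncated subtraction out of the distances.
\<close>

definition binsum :: "nat \<Rightarrow> (nat \<Rightarrow> nat \<Rightarrow> real) \<Rightarrow> real" where
  "binsum n g = (\<Sum>i\<le>n. real (n choose i) * g i (n - i))"

lemma binsum_0 [simp]: "binsum 0 g = g 0 0"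
  by (simp add: binsum_def)

text \<open>
  Appending a zero or a one to a word of length \<open>n\<close>; this is Pascal's rule.
\<close>

lemma binsum_Suc: "binsum (Suc n) g = binsum n (\<lambda>i i'. g i (Suc i') + g (Suc i) i')"
proof -
  have "binsum (Suc n) g =
      g 0 (Suc n) + (\<Sum>i\<le>n. real (Suc n choose Suc i) * g (Suc i) (n - i))"
    by (simp only: binsum_def sum.atMost_Suc_shift) simp
  also have "\<dots> = (g 0 (Suc n) + (\<Sum>i\<le>n. real (n choose Suc i) * g (Suc i) (Suc n - Suc i)))
      + (\<Sum>i\<le>n. real (n choose i) * g (Suc i) (n - i))"
    by (simp add: distrib_right sum.distrib)
  also have "g 0 (Suc n) + (\<Sum>i\<le>n. real (n choose Suc i) * g (Suc i) (Suc n - Suc i))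
      = (\<Sum>i\<le>Suc n. real (n choose i) * g i (Suc n - i))"
    by (simp only: sum.atMost_Suc_shift) simp
  also have "\<dots> = (\<Sum>i\<le>n. real (n choose i) * g i (Suc (n - i)))"
    by (simp add: Suc_diff_le)
  finally show ?thesis
    by (simp add: binsum_def distrib_left sum.distrib)
qed

text \<open>
  Complementing the words exchanges ones and zeros.
\<close>

lemma binsum_reflect: "binsum n g = binsum n (\<lambda>i i'. g i' i)"
  unfolding binsum_def
  by (rule sum.reindex_bij_witness[where i = "\<lambda>i. n - i" and j = "\<lambda>i. n - i"])
     (auto simp: binomial_symmetric[of _ n, symmetric])

lemma binsum_swap:
  "binsum a (\<lambda>i i'. binsum b (\<lambda>j j'. g i i' j j')) = binsum b (\<lambda>j j'. binsum a (\<lambda>i i'. g i i' j j'))"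
  unfolding binsum_def
  by (simp add: sum_distrib_left mult.left_commute) (rule sum.swap)

lemma binsum_cong: "(\<And>i i'. i + i' = n \<Longrightarrow> g i i' = h i i') \<Longrightarrow> binsum n g = binsum n h"
  unfolding binsum_def by (intro sum.cong) auto

lemma binsum_add: "binsum n (\<lambda>i i'. g i i' + h i i') = binsum n g + binsum n h"
  by (simp add: binsum_def distrib_left sum.distrib)

lemma binsum_diff: "binsum n (\<lambda>i i'. g i i' - h i i') = binsum n g - binsum n h"
  by (simp add: binsum_def right_diff_distrib sum_subtractf)

lemma binsum_scale: "binsum n (\<lambda>i i'. x * g i i') = x * binsum n g"
  by (simp add: binsum_def sum_distrib_left mult.left_commute)

lemma binsum_power: "binsum n (\<lambda>i i'. x ^ i) = (1 + x) ^ n"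
  using binomial_ring[of x 1 n] by (simp add: binsum_def add.commute)

definition binsum3 where
  "binsum3 a b c H = binsum a (\<lambda>i i'. binsum b (\<lambda>j j'. binsum c (\<lambda>k k'. H i i' j j' k k')))"

section \<open>The distance enumerator of a linear code\<close>

text \<open>
  A word has \<open>i\<close> ones and \<open>i'\<close> zeros in the columns of type 3, and similarly \<open>j\<close>, \<open>j'\<close> for type 5 and
  \<open>k\<close>, \<open>k'\<close> for type 6. The four sums are its distances to the rows 0, 1, 2, 3.
\<close>

definition nearest_dist :: "nat \<Rightarrow> nat \<Rightarrow> nat \<Rightarrow> nat \<Rightarrow> nat \<Rightarrow> nat \<Rightarrow> nat" where
  "nearest_dist i i' j j' k k' =
     min (min (i + j + k) (i + j' + k')) (min (i' + j + k') (i' + j' + k))"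

definition distance_enumerator :: "real \<Rightarrow> nat \<Rightarrow> nat \<Rightarrow> nat \<Rightarrow> real" where
  "distance_enumerator q a b c = binsum3 a b c (\<lambda>i i' j j' k k'. q ^ nearest_dist i i' j j' k k')"

text \<open>
  The contribution of the words whose nearest codewords are exactly the rows 0 and 1: the first
  condition says that these two distances agree, the others that row 2 and row 3 are farther away.
\<close>

definition pair_tie_sum :: "real \<Rightarrow> nat \<Rightarrow> nat \<Rightarrow> nat \<Rightarrow> real" where
  "pair_tie_sum q a b c = binsum3 a b c (\<lambda>i i' j j' k k'.
     of_bool (j + k = j' + k' \<and> i + k < i' + k' \<and> i + j < i' + j') * q ^ (i + j + k))"

lemma binsum3_Suc:
  "binsum3 (Suc a) b c H =
     binsum3 a b c (\<lambda>i i' j j' k k'. H i (Suc i') j j' k k' + H (Suc i) i' j j' k k')"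
  by (simp add: binsum3_def binsum_Suc binsum_add)

lemma binsum3_swap12: "binsum3 a b c H = binsum3 b a c (\<lambda>j j' i i'. H i i' j j')"
  unfolding binsum3_def by (rule binsum_swap)

lemma binsum3_swap23: "binsum3 a b c H = binsum3 a c b (\<lambda>i i' k k' j j'. H i i' j j' k k')"
  unfolding binsum3_def by (subst binsum_swap) simp

lemma binsum3_cong:
  assumes "\<And>i i' j j' k k'. i + i' = a \<Longrightarrow> j + j' = b \<Longrightarrow> k + k' = c \<Longrightarrow>
    H i i' j j' k k' = H' i i' j j' k k'"
  shows "binsum3 a b c H = binsum3 a b c H'"
  unfolding binsum3_def by (intro binsum_cong assms)

lemma binsum3_linear:
  "binsum3 a b c (\<lambda>i i' j j' k k'. H i i' j j' k k' + H' i i' j j' k k')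
     = binsum3 a b c H + binsum3 a b c H'"
  "binsum3 a b c (\<lambda>i i' j j' k k'. H i i' j j' k k' - H' i i' j j' k k')
     = binsum3 a b c H - binsum3 a b c H'"
  "binsum3 a b c (\<lambda>i i' j j' k k'. x * H i i' j j' k k') = x * binsum3 a b c H"
  by (simp_all add: binsum3_def binsum_add binsum_diff binsum_scale)

text \<open>
  The next two reflections translate the words by row 2 and by row 1, respectively.
\<close>

lemma binsum3_reflect13:
  "binsum3 a b c H = binsum3 a b c (\<lambda>i i' j j' k k'. H i' i j j' k' k)"
  unfolding binsum3_def by (subst (1 3) binsum_reflect) simp

lemma binsum3_reflect23:
  "binsum3 a b c H = binsum3 a b c (\<lambda>i i' j j' k k'. H i i' j' j k' k)"
  unfolding binsum3_def by (subst (2 3) binsum_reflect) simp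

lemma binsum3_as_sum:
  "binsum3 a b c H = (\<Sum>(i, j, k)\<in>{..a} \<times> {..b} \<times> {..c}.
     real (a choose i) * real (b choose j) * real (c choose k) * H i (a - i) j (b - j) k (c - k))"
  by (simp add: binsum3_def binsum_def sum_distrib_left sum.cartesian_product mult.assoc
      flip: sum.cartesian_product)

section \<open>Comparing two columns\<close>

text \<open>
  Let \<open>x\<close> and \<open>y\<close> be the distances to the two pairs of rows that a new column separates. The left-hand
  side adds up the two words that extend the given one. Without a tie the nearer pair stays
  at least as near as the other one whichever bit is appended, so the new column acts like a zero column.
  Only a tie yields the additional term.
\<close>

lemma extra_column_tie:
  fixes q :: real
  shows "q ^ min x (Suc y) + q ^ min (Suc x) y
    = (1 + q) * q ^ min x y + (1 - q) * (of_bool (x = y) * q ^ x)"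
  by (cases x y rule: linorder_cases) (auto simp: min_absorb1 min_absorb2 Suc_le_eq algebra_simps)

lemma nearest_dist_Suc:
  "nearest_dist i (Suc i') j j' k k' =
     min (min (i + j + k) (i + j' + k')) (Suc (min (i' + j + k') (i' + j' + k)))"
  "nearest_dist (Suc i) i' j j' k k' =
     min (Suc (min (i + j + k) (i + j' + k'))) (min (i' + j + k') (i' + j' + k))"
  by (auto simp: nearest_dist_def)

lemma distance_enumerator_swap12: "distance_enumerator q a b c = distance_enumerator q b a c"
  unfolding distance_enumerator_def
  by (subst binsum3_swap12) (simp add: nearest_dist_def add_ac min.commute min.left_commute min.assoc)

lemma distance_enumerator_swap23: "distance_enumerator q a b c = distance_enumerator q a c b"
  unfolding distance_enumerator_def
  by (subst binsum3_swap23) (simp add: nearest_dist_def add_ac min.commute min.left_commute min.assoc)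

text \<open>
  The words that are equally far from \<open>{row 0, row 1}\<close> and from \<open>{row 2, row 3}\<close>, which are the words that
  profit from one more column of type 3.
\<close>

definition split_tie_sum :: "real \<Rightarrow> nat \<Rightarrow> nat \<Rightarrow> nat \<Rightarrow> real" where
  "split_tie_sum q a b c = binsum3 a b c (\<lambda>i i' j j' k k'.
     of_bool (min (i + j + k) (i + j' + k') = min (i' + j + k') (i' + j' + k)) *
     q ^ min (i + j + k) (i + j' + k'))"

lemma distance_enumerator_Suc:
  "distance_enumerator q (Suc a) b c = (1 + q) * distance_enumerator q a b c + (1 - q) * split_tie_sum q a b c"
proof -
  have "distance_enumerator q (Suc a) b c = binsum3 a b c (\<lambda>i i' j j' k k'.
      (1 + q) * q ^ nearest_dist i i' j j' k k' + (1 - q) *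
      (of_bool (min (i + j + k) (i + j' + k') = min (i' + j + k') (i' + j' + k)) *
      q ^ min (i + j + k) (i + j' + k')))"
    unfolding distance_enumerator_def binsum3_Suc nearest_dist_Suc extra_column_tie
    by (simp add: nearest_dist_def)
  then show ?thesis
    by (simp add: binsum3_linear distance_enumerator_def split_tie_sum_def)
qed

text \<open>
  Here \<open>w\<close>, \<open>x\<close>, \<open>y\<close>, \<open>z\<close> are the distances to the rows 0, 1, 2, 3. If at least three rows are nearest,
  or if the nearest rows are 0, 3 or 1, 2, then both partitions are tied and the terms cancel. Ties of exactly
  two rows inside one block of a partition are ties of the other partition only.
\<close>

lemma two_ties_diff:
  fixes w x y z :: nat and q :: real
  shows "of_bool (min w x = min y z) * q ^ min w x - of_bool (min w y = min x z) * q ^ min w y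
    = of_bool (w = y \<and> w < x \<and> w < z) * q ^ w + of_bool (x = z \<and> x < w \<and> x < y) * q ^ x
      - of_bool (w = x \<and> w < y \<and> w < z) * q ^ w - of_bool (y = z \<and> y < w \<and> y < x) * q ^ y"
  by (cases w x rule: linorder_cases; cases y z rule: linorder_cases;
      cases w y rule: linorder_cases; cases x z rule: linorder_cases; simp add: min_def)

text \<open>
  The four kinds of ties in \<open>two_ties_diff\<close> fall into two pairs, and the members of each pair are
  exchanged by a translation by a codeword.
\<close>

lemma split_tie_sum_diff:
  "split_tie_sum q a b c - split_tie_sum q b a c = 2 * (pair_tie_sum q b a c - pair_tie_sum q a b c)"
proof -
  define P where "P = (\<lambda>i i' j j' k k'. of_bool (j + k = j' + k' \<and> i + k < i' + k' \<and> i + j < i' + j') *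
     q ^ (i + j + k))"
  have E1: "pair_tie_sum q a b c = binsum3 a b c P"
    by (simp add: pair_tie_sum_def P_def)
  have E2: "pair_tie_sum q b a c = binsum3 a b c (\<lambda>i i' j j'. P j j' i i')"
    unfolding pair_tie_sum_def P_def by (rule binsum3_swap12)
  have E1': "pair_tie_sum q a b c = binsum3 a b c (\<lambda>i i' j j' k k'. P i' i j j' k' k)"
    unfolding E1 by (rule binsum3_reflect13)
  have E2': "pair_tie_sum q b a c = binsum3 a b c (\<lambda>i i' j j' k k'. P j' j i i' k' k)"
    unfolding E2 by (rule binsum3_reflect23)
  have S2: "split_tie_sum q b a c = binsum3 a b c (\<lambda>i i' j j' k k'.
     of_bool (min (i + j + k) (i' + j + k') = min (i + j' + k') (i' + j' + k)) *
     q ^ min (i + j + k) (i' + j + k'))"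
    unfolding split_tie_sum_def by (subst binsum3_swap12) (simp add: add_ac)
  have "split_tie_sum q a b c - split_tie_sum q b a c = binsum3 a b c (\<lambda>i i' j j' k k'.
      P j j' i i' k k' + P j' j i i' k' k - P i i' j j' k k' - P i' i j j' k' k)"
    unfolding S2 unfolding split_tie_sum_def binsum3_linear(2)[symmetric] two_ties_diff
    unfolding P_def by (intro binsum3_cong) (simp add: add_ac conj_commute)
  also have "\<dots> = 2 * (pair_tie_sum q b a c - pair_tie_sum q a b c)"
    by (simp add: binsum3_linear E1[symmetric] E2[symmetric] E1'[symmetric] E2'[symmetric])
  finally show ?thesis .
qed

lemma distance_enumerator_diff:
  "distance_enumerator q (Suc a) b c - distance_enumerator q a (Suc b) c
     = 2 * (1 - q) * (pair_tie_sum q b a c - pair_tie_sum q a b c)"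
proof -
  have "distance_enumerator q (Suc a) b c - distance_enumerator q a (Suc b) c
      = (1 - q) * (split_tie_sum q a b c - split_tie_sum q b a c)"
    by (simp add: distance_enumerator_swap12[of q a "Suc b"] distance_enumerator_Suc distance_enumerator_swap12[of q b a]
        algebra_simps)
  then show ?thesis
    unfolding split_tie_sum_diff by (simp only: mult_ac)
qed

text \<open>
  Rows 0 and 1 differ in exactly \<open>b + c\<close> places, so no word is equally far from both if this is odd.
\<close>

lemma pair_tie_sum_odd:
  assumes "odd (b + c)"
  shows "pair_tie_sum q a b c = 0"
proof -
  have "j + k \<noteq> j' + k'" if "j + j' = b" "k + k' = c" for j j' k k'
  proof
    assume "j + k = j' + k'"
    then have "b + c = 2 * (j + k)" using that by simp
    then show False using assms by simp
  qed
  then have "pair_tie_sum q a b c = binsum3 a b c (\<lambda>i i' j j' k k'. 0)"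
    unfolding pair_tie_sum_def by (intro binsum3_cong) simp
  then show ?thesis by (simp add: binsum3_def binsum_def)
qed

text \<open>
  The indices \<open>(i, j, k)\<close> of the words counted by \<open>pair_tie_sum\<close>, with the conditions cleared of the
  numbers of zeros.
\<close>

definition tie_triples :: "nat \<Rightarrow> nat \<Rightarrow> nat \<Rightarrow> (nat \<times> nat \<times> nat) set" where
  "tie_triples a b c = {(i, j, k). i \<le> a \<and> j \<le> b \<and> k \<le> c \<and> 2 * (j + k) = b + c \<and>
     2 * (i + k) < a + c \<and> 2 * (i + j) < a + b}"

lemma finite_tie_triples: "finite (tie_triples a b c)"
  by (rule finite_subset[of _ "{..a} \<times> {..b} \<times> {..c}"]) (auto simp: tie_triples_def)

lemma pair_tie_sum_eq:
  "pair_tie_sum q a b c = (\<Sum>(i, j, k)\<in>tie_triples a b c.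
     real (a choose i) * real (b choose j) * real (c choose k) * q ^ (i + j + k))"
  unfolding pair_tie_sum_def binsum3_as_sum
proof (intro sum.mono_neutral_cong_right)
  show "tie_triples a b c \<subseteq> {..a} \<times> {..b} \<times> {..c}"
    by (auto simp: tie_triples_def)
qed (auto simp: tie_triples_def)

lemma pair_tie_sum_nonneg: "0 < q \<Longrightarrow> 0 \<le> pair_tie_sum q a b c"
  unfolding pair_tie_sum_eq by (intro sum_nonneg) auto

text \<open>
  A word that agrees with the common part of rows 0 and 1 and lies in the middle between them elsewhere.
  For odd \<open>c\<close> the middle is slightly off balance between types 5 and 6, and \<open>a\<close> has to be at least 2 to
  make up for this.
\<close>

lemma tie_triple_exists:
  assumes "even (b + c)" and "2 \<le> a \<or> 1 \<le> a \<and> even c"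
  shows "(0, (b + 1) div 2, c div 2) \<in> tie_triples a b c"
proof (cases "even c")
  case True
  then obtain u v where "c = 2 * u" "b = 2 * v" using assms(1) by (auto elim!: evenE)
  then show ?thesis using assms(2) by (auto simp: tie_triples_def)
next
  case False
  then obtain u v where "c = 2 * u + 1" "b = 2 * v + 1" using assms(1) by (auto elim!: oddE)
  then show ?thesis using assms(2) by (auto simp: tie_triples_def)
qed

lemma pair_tie_sum_pos:
  assumes "0 < q" "even (b + c)" and "2 \<le> a \<or> 1 \<le> a \<and> even c"
  shows "0 < pair_tie_sum q a b c"
  unfolding pair_tie_sum_eq
  using finite_tie_triples tie_triple_exists[OF assms(2,3)]
proof (rule sum_pos2)
  show "0 < (case (0, (b + 1) div 2, c div 2) of (i, j, k) \<Rightarrow>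
      real (a choose i) * real (b choose j) * real (c choose k) * q ^ (i + j + k))"
    using tie_triple_exists[OF assms(2,3)] assms(1) by (auto simp: tie_triples_def)
qed (use assms(1) in auto)

text \<open>
  Passing from \<open>m choose i\<close> to \<open>(m + 2) choose (i + 1)\<close> divides by \<open>(i + 1) (m - i + 1)\<close>, up to a factor
  that depends on \<open>m\<close> alone. This product is larger for \<open>i\<close> closer to \<open>m / 2\<close>.
\<close>

lemma binomial_step_both_sides:
  assumes "i \<le> m"
  shows "(m + 2 choose Suc i) * (Suc i * (m - i + 1)) = (m + 2) * (m + 1) * (m choose i)"
proof -
  have 1: "(m + 2 choose Suc i) * Suc i = (m + 2) * (m + 1 choose i)"
    using Suc_times_binomial[of i "m + 1"] by (simp add: mult.commute)
  have 2: "(m + 1 choose i) * (m - i + 1) = (m + 1) * (m choose i)"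
    using binomial_absorb_comp[of "m + 1" i] assms by (simp add: Suc_diff_le mult.commute)
  have "(m + 2 choose Suc i) * (Suc i * (m - i + 1)) = (m + 2) * ((m + 1 choose i) * (m - i + 1))"
    using 1 by (metis mult.assoc)
  then show ?thesis using 2 by (metis mult.assoc)
qed

text \<open>
  The assumptions say that \<open>s\<close> lies strictly between \<open>i\<close> and \<open>a - i\<close>, hence closer to the centre of the
  \<open>a\<close>-th row of Pascal's triangle. Going down \<open>2 h\<close> rows, a central coefficient grows by a smaller factor
  than an outer one, by \<open>binomial_step_both_sides\<close>.
\<close>

lemma binomial_widening:
  assumes "i < s" "i + s < a"
  shows "(a choose i) * (a + 2 * h choose (s + h)) \<le> (a + 2 * h choose (i + h)) * (a choose s)"
proof (induction h)
  case 0
  then show ?case by simp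
next
  case (Suc h)
  define m I S where "m = a + 2 * h" and "I = i + h" and "S = s + h"
  define x y where "x = Suc I * (m - I + 1)" and "y = Suc S * (m - S + 1)"
  have le: "I \<le> m" "S \<le> m" "I < S" "I + S < m"
    using assms by (auto simp: m_def I_def S_def)
  then obtain d e where d: "S = I + d" "m = I + S + e"
    by (metis less_imp_add_positive)
  have xy: "x \<le> y"
    unfolding x_def y_def d by (simp add: algebra_simps)
  have "(a choose i) * (m + 2 choose Suc S) * y = (m + 2) * (m + 1) * ((a choose i) * (m choose S))"
    using binomial_step_both_sides[OF le(2)] unfolding y_def by (metis mult.assoc mult.left_commute)
  also have "\<dots> \<le> (m + 2) * (m + 1) * ((m choose I) * (a choose s))"
    using Suc.IH unfolding m_def I_def S_def by (intro mult_le_mono2) simp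
  also have "\<dots> = (m + 2 choose Suc I) * (a choose s) * x"
    using binomial_step_both_sides[OF le(1)] unfolding x_def by (metis mult.assoc mult.commute)
  also have "\<dots> \<le> (m + 2 choose Suc I) * (a choose s) * y"
    using xy by simp
  finally have "(a choose i) * (m + 2 choose Suc S) \<le> (m + 2 choose Suc I) * (a choose s)"
    by (subst (asm) mult_le_cancel2) (simp add: y_def)
  then show ?case by (simp add: m_def I_def S_def)
qed

text \<open>
  Write \<open>b = a + 2 h\<close>. The index \<open>(i, j, k)\<close> of the left sum is matched with \<open>(i + h, j - h, k)\<close> on the
  right. The total \<open>i + j + k\<close>, hence the power of \<open>q\<close>, stays the same, and the coefficients
  are compared by \<open>binomial_widening\<close>. Strictness comes from an index on the right whose first entry is 0,
  which is not of the form \<open>i + h\<close>.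
\<close>

lemma pair_tie_sum_less:
  assumes q: "0 < q" and ab: "a < b" and parity: "even (a + b)" "even (a + c)"
  shows "pair_tie_sum q a b c < pair_tie_sum q b a c"
proof -
  define wt where "wt = (\<lambda>a b (i, j, k).
    real (a choose i) * real (b choose j) * real (c choose k) * q ^ (i + j + k))"
  have eq: "pair_tie_sum q a b c = sum (wt a b) (tie_triples a b c)" for a b
    unfolding pair_tie_sum_eq wt_def ..
  obtain h where h: "b = a + 2 * h" "h > 0"
  proof -
    have "even (b - a)" using ab parity(1) by auto
    then obtain h where "b - a = 2 * h" ..
    then show thesis using ab by (intro that[of h]) auto
  qed
  define u where "u = (0 :: nat, (a + 1) div 2, c div 2)"
  have "2 \<le> b \<or> 1 \<le> b \<and> even c" using h by auto
  with parity(2) have u: "u \<in> tie_triples b a c"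
    unfolding u_def by (rule tie_triple_exists)
  have "sum (wt a b) (tie_triples a b c) \<le> sum (wt b a) (tie_triples b a c - {u})"
  proof (rule sum_le_included[where i = "\<lambda>(j, i, k). (j - h, i + h, k)"])
    show "\<forall>t\<in>tie_triples a b c. \<exists>t'\<in>tie_triples b a c - {u}.
        (case t' of (j, i, k) \<Rightarrow> (j - h, i + h, k)) = t \<and> wt a b t \<le> wt b a t'"
    proof
      fix t assume "t \<in> tie_triples a b c"
      then obtain i j k where t: "t = (i, j, k)" "i \<le> a" "j \<le> b" "k \<le> c" "2 * (j + k) = b + c"
        "2 * (i + k) < a + c" "2 * (i + j) < a + b"
        by (auto simp: tie_triples_def)
      \<comment> \<open>The first condition determines \<open>j\<close> from \<open>k\<close>, and the second one then gives room for subtracting \<open>h\<close>.\<close>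
      have "i + h < j" using t(5,6) h(1) by presburger
      then have "h \<le> j" by simp
      then obtain s where "j = s + h" by (metis le_add_diff_inverse2)
      with \<open>i + h < j\<close> t(7) h(1) have s: "j = s + h" "i < s" "i + s < a" by simp_all
      let ?t' = "(i + h, s, k)"
      have "?t' \<in> tie_triples b a c - {u}"
        using t(2-7) s h by (simp add: tie_triples_def u_def)
      moreover have "wt a b t \<le> wt b a ?t'"
      proof -
        have "real (a choose i) * real (b choose j) \<le> real (b choose (i + h)) * real (a choose s)"
          using binomial_widening[OF s(2,3), of h] unfolding s(1) h(1)
          by (metis of_nat_le_iff of_nat_mult)
        then have "real (a choose i) * real (b choose j) * (real (c choose k) * q ^ (i + j + k)) \<le>
            real (b choose (i + h)) * real (a choose s) * (real (c choose k) * q ^ (i + j + k))"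
          using q by (intro mult_right_mono) auto
        moreover have "i + h + s + k = i + j + k" using s by simp
        ultimately show ?thesis by (simp only: wt_def t(1) prod.case mult.assoc)
      qed
      ultimately show "\<exists>t'\<in>tie_triples b a c - {u}.
        (case t' of (j, i, k) \<Rightarrow> (j - h, i + h, k)) = t \<and> wt a b t \<le> wt b a t'"
        using s t(1) by (intro bexI[of _ ?t']) auto
    qed
  qed (use q finite_tie_triples in \<open>auto simp: wt_def\<close>)
  also have "\<dots> < sum (wt b a) (tie_triples b a c)"
  proof -
    have "0 < wt b a u" using u q by (auto simp: wt_def tie_triples_def u_def)
    then show ?thesis using u finite_tie_triples by (simp add: sum.remove)
  qed
  finally show ?thesis unfolding eq .
qed

section \<open>The value of a profile\<close>

text \<open>
  Four times the success probability of a linear code with the given profile and any number of zero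
  columns, as a function of \<open>q = \<epsilon> / (1 - \<epsilon>)\<close>; see \<open>success_prob_eq_profile_value\<close>.
\<close>

definition profile_value :: "real \<Rightarrow> nat \<Rightarrow> nat \<Rightarrow> nat \<Rightarrow> real" where
  "profile_value q a b c = distance_enumerator q a b c / (1 + q) ^ (a + b + c)"

lemma profile_value_swap12: "profile_value q a b c = profile_value q b a c"
  by (simp add: profile_value_def distance_enumerator_swap12[of q a b] add_ac)

lemma profile_value_swap23: "profile_value q a b c = profile_value q a c b"
  by (simp add: profile_value_def distance_enumerator_swap23[of q a b] add_ac)

text \<open>
  By \<open>distance_enumerator_Suc\<close> the gain over a zero column is a sum of nonnegative terms over ties.
\<close>

lemma profile_value_mono_Suc:
  assumes "0 < q" "q < 1"
  shows "profile_value q a b c \<le> profile_value q (Suc a) b c"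
proof -
  have "0 \<le> split_tie_sum q a b c"
    unfolding split_tie_sum_def binsum3_as_sum using assms by (intro sum_nonneg) auto
  then have "(1 + q) * distance_enumerator q a b c \<le> distance_enumerator q (Suc a) b c"
    using assms by (simp add: distance_enumerator_Suc)
  then show ?thesis
    using assms by (simp add: profile_value_def divide_simps mult.commute mult.left_commute)
qed

lemma profile_value_transfer:
  "profile_value q (Suc a) b c - profile_value q a (Suc b) c
     = 2 * (1 - q) / (1 + q) ^ Suc (a + b + c) * (pair_tie_sum q b a c - pair_tie_sum q a b c)"
  using distance_enumerator_diff[of q a b c]
  by (simp add: profile_value_def flip: diff_divide_distrib)

context
  fixes q :: real
  assumes q: "0 < q" "q < 1"
begin

lemma transfer_iff:
  "profile_value q a (Suc b) c \<le> profile_value q (Suc a) b c \<longleftrightarrow>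
     pair_tie_sum q a b c \<le> pair_tie_sum q b a c"
  "profile_value q a (Suc b) c < profile_value q (Suc a) b c \<longleftrightarrow>
     pair_tie_sum q a b c < pair_tie_sum q b a c"
proof -
  have pos: "0 < 2 * (1 - q) / (1 + q) ^ Suc (a + b + c)" using q by simp
  show "profile_value q a (Suc b) c \<le> profile_value q (Suc a) b c \<longleftrightarrow>
      pair_tie_sum q a b c \<le> pair_tie_sum q b a c"
    "profile_value q a (Suc b) c < profile_value q (Suc a) b c \<longleftrightarrow>
      pair_tie_sum q a b c < pair_tie_sum q b a c"
    using profile_value_transfer[of q a b c] zero_le_mult_iff zero_less_mult_iff pos
    by (smt (verit))+
qed

lemma transfer_le:
  assumes "odd (b + c)"
  shows "profile_value q a (Suc b) c \<le> profile_value q (Suc a) b c"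
  using assms q by (simp add: transfer_iff pair_tie_sum_odd pair_tie_sum_nonneg)

lemma transfer_eq:
  assumes "odd (b + c)" "odd (a + c)"
  shows "profile_value q (Suc a) b c = profile_value q a (Suc b) c"
  using profile_value_transfer[of q a b c] assms by (simp add: pair_tie_sum_odd)

lemma transfer_mixed_less:
  assumes "odd (b + c)" "even (a + c)" "2 \<le> b \<or> 1 \<le> b \<and> even c"
  shows "profile_value q a (Suc b) c < profile_value q (Suc a) b c"
  using assms q by (simp add: transfer_iff pair_tie_sum_odd pair_tie_sum_pos)

lemma transfer_same_parity_less:
  assumes "even (a + b)" "even (a + c)" "a < b"
  shows "profile_value q a (Suc b) c < profile_value q (Suc a) b c"
  using assms q by (simp add: transfer_iff pair_tie_sum_less)

end

lemma mset_pair_cases: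
  assumes "{#b, c#} = {#y, z#}"
  shows "b = y \<and> c = z \<or> b = z \<and> c = y"
proof (cases "b = y")
  case False
  have "b \<in># {#y, z#}" by (simp flip: assms)
  with False have "b = z" by simp
  with assms show ?thesis by (simp add: add_mset_commute)
qed (use assms in simp)

lemma mset_triple_cases:
  assumes "{#a, b, c#} = {#x, y, z#}"
  shows "(a, b, c) \<in> {(x, y, z), (x, z, y), (y, x, z), (y, z, x), (z, x, y), (z, y, x)}"
proof -
  have "a \<in># {#x, y, z#}" by (simp flip: assms)
  then consider "a = x" | "a = y" | "a = z" by auto
  then show ?thesis
  proof cases
    case 1
    with assms have "{#b, c#} = {#y, z#}" by simp
    with 1 show ?thesis using mset_pair_cases[of b c y z] by auto
  next
    case 2
    with assms have "add_mset y {#b, c#} = add_mset y {#x, z#}" by (simp only: add_mset_commute)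
    with 2 show ?thesis using mset_pair_cases[of b c x z] by auto
  next
    case 3
    with assms have "add_mset z {#b, c#} = add_mset z {#x, y#}" by (simp only: add_mset_commute)
    with 3 show ?thesis using mset_pair_cases[of b c x y] by auto
  qed
qed

lemma profile_value_mset:
  assumes "{#a, b, c#} = {#x, y, z#}"
  shows "profile_value q a b c = profile_value q x y z"
proof -
  have "profile_value q x z y = profile_value q x y z" by (rule profile_value_swap23)
  moreover have "profile_value q y x z = profile_value q x y z" by (rule profile_value_swap12)
  moreover have "profile_value q y z x = profile_value q y x z" by (rule profile_value_swap23)
  moreover have "profile_value q z x y = profile_value q x z y" by (rule profile_value_swap12)
  moreover have "profile_value q z y x = profile_value q y z x" by (rule profile_value_swap12)
  ultimately show ?thesis using mset_triple_cases[OF assms] by auto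
qed

section \<open>Optimal profiles\<close>

text \<open>
  Sums below \<open>n\<close> account for zero columns in a code of blocklength \<open>n\<close>.
\<close>

definition improvable :: "real \<Rightarrow> nat \<Rightarrow> nat \<Rightarrow> nat \<Rightarrow> nat \<Rightarrow> bool" where
  "improvable q n a b c \<longleftrightarrow>
     (\<exists>a' b' c'. a' + b' + c' \<le> n \<and> profile_value q a b c < profile_value q a' b' c')"

lemma improvable_swap12: "improvable q n a b c = improvable q n b a c"
  unfolding improvable_def profile_value_swap12[of q a b] ..

lemma improvable_swap23: "improvable q n a b c = improvable q n a c b"
  unfolding improvable_def profile_value_swap23[of q a b] ..

lemma improvable_if_le:
  "profile_value q a b c \<le> profile_value q a' b' c' \<Longrightarrow> improvable q n a' b' c' \<Longrightarrow>
    improvable q n a b c"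
  unfolding improvable_def using order_le_less_trans by blast

lemma improvableI:
  "profile_value q a b c < profile_value q a' b' c' \<Longrightarrow> a' + b' + c' \<le> n \<Longrightarrow> improvable q n a b c"
  unfolding improvable_def by blast

text \<open>
  There are finitely many profiles, so the maximal value is attained, and it is attained at a profile
  that cannot be improved. It suffices to know the common value of these profiles.
\<close>

lemma value_less_if_improvable:
  assumes unimp: "\<And>a b c. a + b + c \<le> n \<Longrightarrow> \<not> improvable q n a b c \<Longrightarrow> profile_value q a b c = v"
    and imp: "improvable q n a b c"
  shows "profile_value q a b c < v"
proof -
  define P where "P = {(a, b, c). a + b + c \<le> n}"
  define g where "g = (\<lambda>(a, b, c). profile_value q a b c)"
  have "P \<subseteq> {..n} \<times> {..n} \<times> {..n}" by (auto simp: P_def)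
  then have fin: "finite P" by (rule finite_subset) simp
  have "(0, 0, 0) \<in> P" by (simp add: P_def)
  then have ne: "P \<noteq> {}" by auto
  have "Max (g ` P) \<in> g ` P" using fin ne by (intro Max_in) auto
  then obtain x y z where m: "(x, y, z) \<in> P" "Max (g ` P) = g (x, y, z)" by auto
  have max: "profile_value q a b c \<le> profile_value q x y z" if "a + b + c \<le> n" for a b c
  proof -
    have "g (a, b, c) \<le> Max (g ` P)" using that fin by (intro Max_ge) (auto simp: P_def)
    then show ?thesis unfolding m(2) by (simp add: g_def)
  qed
  then have "\<not> improvable q n x y z" unfolding improvable_def by (simp add: not_less)
  then have "profile_value q x y z = v" using m(1) unimp by (simp add: P_def)
  with max imp show ?thesis unfolding improvable_def by fastforce
qed

text \<open>
  Triples of numbers of the same parity with minimum \<open>t\<close> and pairwise differences at most 2.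
\<close>

definition balanced_triples :: "nat \<Rightarrow> (nat \<times> nat \<times> nat) set" where
  "balanced_triples t = {(t, t, t), (t + 2, t, t), (t, t + 2, t), (t, t, t + 2),
     (t + 2, t + 2, t), (t + 2, t, t + 2), (t, t + 2, t + 2)}"

lemma balanced_triples_exists:
  assumes "x = y \<or> x = y + 2 \<or> y = x + 2" "x = z \<or> x = z + 2 \<or> z = x + 2"
    "y = z \<or> y = z + 2 \<or> z = y + 2"
  shows "\<exists>t. (x, y, z) \<in> balanced_triples t"
proof -
  consider "x \<le> y" "x \<le> z" | "y \<le> x" "y \<le> z" | "z \<le> x" "z \<le> y" by linarith
  then show ?thesis
  proof cases
    case 1
    then have "y = x \<or> y = x + 2" "z = x \<or> z = x + 2" using assms(1,2) by linarith+
    then show ?thesis unfolding balanced_triples_def by (intro exI[of _ x]) auto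
  next
    case 2
    then have "x = y \<or> x = y + 2" "z = y \<or> z = y + 2" using assms(1,3) by linarith+
    then show ?thesis unfolding balanced_triples_def by (intro exI[of _ y]) auto
  next
    case 3
    then have "x = z \<or> x = z + 2" "y = z \<or> y = z + 2" using assms(2,3) by linarith+
    then show ?thesis unfolding balanced_triples_def by (intro exI[of _ z]) auto
  qed
qed

context
  fixes q :: real and n :: nat
  assumes q: "0 < q" "q < 1"
begin

text \<open>
  One column moves from the first type to the second. Relative to the profile without this column
  only one of the two tie sums can be nonzero, and it is positive since \<open>a\<close> is large enough.
\<close>

lemma same_parity_large_improvable:
  assumes "even (a + b)" "even (a + c)" "a + b + c \<le> n" "2 \<le> a" "even a \<or> 3 \<le> a"
  shows "improvable q n a b c"
proof -
  obtain a' where a': "a = Suc a'" using assms(4) by (cases a) auto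
  have "profile_value q b (Suc a') c < profile_value q (Suc b) a' c"
    using assms a' by (intro transfer_mixed_less[OF q]) auto
  then show ?thesis
    using assms(3) a' by (intro improvableI[of _ _ _ _ "Suc b" a' c]) (auto simp: profile_value_swap12)
qed

text \<open>
  If no entry is large enough for \<open>same_parity_large_improvable\<close>, the profile is \<open>(0, 0, 0)\<close> or \<open>(1, 1, 1)\<close>.
  For these, chains of weak inequalities lead to \<open>(2, 0, 0)\<close> and \<open>(2, 0, 2)\<close>, which are large.
\<close>

lemma same_parity_improvable:
  assumes "even (a + b)" "even (a + c)" "a + b + c \<le> n" "2 \<le> n" "n \<noteq> 3"
  shows "improvable q n a b c"
proof -
  define large where "large = (\<lambda>m::nat. 2 \<le> m \<and> (even m \<or> 3 \<le> m))"
  have small: "m \<le> 1" if "\<not> large m" for m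
    using that unfolding large_def by (cases "m = 2") auto
  consider "large a" | "large b" | "large c" | "\<not> large a" "\<not> large b" "\<not> large c" by blast
  then show ?thesis
  proof cases
    case 1
    then show ?thesis using assms same_parity_large_improvable by (simp add: large_def)
  next
    case 2
    then have "improvable q n b a c"
      using assms by (intro same_parity_large_improvable) (auto simp: large_def)
    then show ?thesis using improvable_swap12 by blast
  next
    case 3
    then have "improvable q n c a b"
      using assms by (intro same_parity_large_improvable) (auto simp: large_def)
    then show ?thesis using improvable_swap12 improvable_swap23 by blast
  next
    case 4
    with small have "a \<le> 1" "b \<le> 1" "c \<le> 1" by auto
    with assms(1,2) consider "a = 0" "b = 0" "c = 0" | "a = 1" "b = 1" "c = 1"
      by (cases a; cases b; cases c) auto
    then show ?thesis
    proof cases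
      case 1
      have "improvable q n 2 0 0" using assms(4) by (intro same_parity_large_improvable) auto
      moreover have "profile_value q 0 0 0 \<le> profile_value q 2 0 0"
        using profile_value_mono_Suc[OF q, of 0 0 0] profile_value_mono_Suc[OF q, of 1 0 0]
        by (simp add: numeral_2_eq_2)
      ultimately show ?thesis using 1 improvable_if_le by blast
    next
      case 2
      have "improvable q n 2 0 2"
        using assms(3-5) 2 by (intro same_parity_large_improvable) auto
      moreover have "profile_value q 1 1 1 \<le> profile_value q 2 0 1"
        using transfer_le[OF q, of 0 1 1] by (simp add: numeral_2_eq_2)
      moreover have "profile_value q 1 0 2 \<le> profile_value q 2 0 2"
        using profile_value_mono_Suc[OF q, of 1 0 2] by (simp add: numeral_2_eq_2)
      moreover have "profile_value q 2 0 1 = profile_value q 1 0 2"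
        by (rule profile_value_mset) simp
      ultimately show ?thesis using 2 improvable_if_le by (metis order_trans)
    qed
  qed
qed

text \<open>
  A zero column is replaced so that all entries get the same parity, which does not decrease the value.
\<close>

lemma mixed_parity_short_improvable:
  assumes "even (a + b)" "odd (a + c)" "a + b + c < n" "2 \<le> n" "n \<noteq> 3"
  shows "improvable q n a b c"
proof -
  have "improvable q n (Suc c) a b"
    using assms by (intro same_parity_improvable) auto
  moreover have "profile_value q a b c \<le> profile_value q (Suc c) a b"
    using profile_value_mono_Suc[OF q, of c a b] profile_value_mset[of a b c c a b q]
    by (simp add: add_mset_commute)
  ultimately show ?thesis using improvable_if_le by blast
qed

text \<open>
  Without the column that moves from the third type to the first, all entries have the same parity,
  so this is the situation of \<open>pair_tie_sum_less\<close>.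
\<close>

lemma large_odd_one_improvable:
  assumes "even (a + b)" "odd (a + c)" "a + b + c \<le> n" "a + 3 \<le> c"
  shows "improvable q n a b c"
proof -
  obtain c' where c': "c = Suc c'" using assms(4) by (cases c) auto
  have "profile_value q a (Suc c') b < profile_value q (Suc a) c' b"
    using assms c' by (intro transfer_same_parity_less[OF q]) auto
  then show ?thesis
    using assms(3) c' by (intro improvableI[of _ _ _ _ "Suc a" c' b]) (auto simp: profile_value_swap23)
qed

text \<open>
  The profile has the same value as \<open>(a - 1, b, c + 1)\<close>, where \<open>a - 1\<close> is now the entry whose parity is
  different from the other two. It is so large that \<open>large_odd_one_improvable\<close> applies.
\<close>

lemma large_pair_member_improvable:
  assumes "even (a + b)" "odd (a + c)" "a + b + c \<le> n" "b + 4 \<le> a \<or> c + 5 \<le> a"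
  shows "improvable q n a b c"
proof -
  obtain a' where a': "a = Suc a'" using assms(4) by (cases a) auto
  have "improvable q n b (Suc c) a'"
  proof (cases "b + 4 \<le> a")
    case True
    then show ?thesis using assms a' by (intro large_odd_one_improvable) auto
  next
    case False
    then have "improvable q n (Suc c) b a'"
      using assms a' by (intro large_odd_one_improvable) auto
    then show ?thesis using improvable_swap12 by blast
  qed
  moreover have "profile_value q a b c = profile_value q b (Suc c) a'"
  proof -
    have "profile_value q (Suc a') c b = profile_value q a' (Suc c) b"
      using assms a' by (intro transfer_eq[OF q]) auto
    then show ?thesis
      using profile_value_mset[of a b c "Suc a'" c b q]
        profile_value_mset[of b "Suc c" a' a' "Suc c" b q] a'
      by (simp add: add_mset_commute)
  qed
  ultimately show ?thesis using improvable_if_le by (metis order_refl)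
qed

lemma not_improvable_balanced:
  assumes "\<not> improvable q n a b c" "a + b + c \<le> n" "2 \<le> n" "n \<noteq> 3"
  obtains x y z where "{#a, b, c#} = {#x, y, z#}" "even (x + y)" "odd (x + z)" "x + y + z = n"
    "z < x + 3" "z < y + 3" "x < y + 4" "y < x + 4" "x < z + 5" "y < z + 5"
proof -
  have "\<not> (even (a + b) \<and> even (a + c))"
    using same_parity_improvable assms by blast
  then consider "even (a + b)" "odd (a + c)" | "even (a + c)" "odd (a + b)" | "even (b + c)" "odd (b + a)"
    by (auto)
  then obtain x y z where xyz: "{#a, b, c#} = {#x, y, z#}" "even (x + y)" "odd (x + z)"
    by cases (metis add_mset_commute)+
  have sum: "x + y + z = a + b + c"
    using arg_cong[OF xyz(1), of sum_mset] by simp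
  have un: "\<not> improvable q n x y z"
    using assms(1) profile_value_mset[OF xyz(1)] by (simp add: improvable_def)
  then have un': "\<not> improvable q n y x z" using improvable_swap12 by blast
  have par: "even (y + x)" "odd (y + z)" using xyz by auto
  have le: "x + y + z \<le> n" "y + x + z \<le> n" using sum assms(2) by auto
  show thesis
  proof (rule that[OF xyz])
    show "x + y + z = n"
      using mixed_parity_short_improvable[OF xyz(2,3)] un le assms by force
    show "z < x + 3" "z < y + 3"
      using large_odd_one_improvable[OF xyz(2,3) le(1)] large_odd_one_improvable[OF par le(2)] un un'
      by force+
    show "x < y + 4" "y < x + 4" "x < z + 5" "y < z + 5"
      using large_pair_member_improvable[OF xyz(2,3) le(1)]
        large_pair_member_improvable[OF par le(2)] un un'
      by force+
  qed
qed

text \<open>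
  For a mixed profile, the triple of equal parities obtained by raising the odd one out by 1 is balanced.
  The strict bounds of \<open>not_improvable_balanced\<close> together with the parities give differences of at
  most 2.
\<close>

lemma not_improvable_spread:
  assumes "\<not> improvable q n a b c" "a + b + c \<le> n" "2 \<le> n" "n \<noteq> 3"
  obtains x y z t :: nat where "{#a, b, c#} = {#x, y, z#}" "x + y + Suc z = n + 1"
    "(x, y, Suc z) \<in> balanced_triples t"
proof -
  obtain x y z where xyz: "{#a, b, c#} = {#x, y, z#}" "even (x + y)" "odd (x + z)" "x + y + z = n"
    "z < x + 3" "z < y + 3" "x < y + 4" "y < x + 4" "x < z + 5" "y < z + 5"
    using not_improvable_balanced[OF assms] .
  have "x = y \<or> x = y + 2 \<or> y = x + 2" using xyz(2,7,8) by presburger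
  moreover have "x = Suc z \<or> x = Suc z + 2 \<or> Suc z = x + 2" using xyz(3,5,9) by presburger
  moreover have "odd (y + z)" using xyz(2,3) by auto
  then have "y = Suc z \<or> y = Suc z + 2 \<or> Suc z = y + 2" using xyz(6,10) by presburger
  ultimately obtain t where t: "(x, y, Suc z) \<in> balanced_triples t"
    using balanced_triples_exists by blast
  show thesis by (rule that[OF xyz(1) _ t]) (use xyz(4) in simp)
qed

end

lemma not_improvable_3k_minus_1:
  assumes "\<not> improvable q (3 * k - 1) a b c" "0 < q" "q < 1" "1 \<le> k" "a + b + c \<le> 3 * k - 1"
  shows "{#a, b, c#} = {#k, k, k - 1#}"
proof -
  have n: "2 \<le> 3 * k - 1" "3 * k - 1 \<noteq> 3" "3 * k - 1 + 1 = 3 * k" using assms(4) by presburger+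
  obtain x y z t where xyz: "{#a, b, c#} = {#x, y, z#}" "x + y + Suc z = 3 * k"
    "(x, y, Suc z) \<in> balanced_triples t"
    using not_improvable_spread[OF assms(2,3,1,5) n(1,2)] n(3) by metis
  \<comment> \<open>The sum of a balanced triple is \<open>3 t\<close>, \<open>3 t + 2\<close> or \<open>3 t + 4\<close>; its residue modulo 3 determines the shape.\<close>
  have "t + t + t + 2 \<noteq> 3 * k" "t + t + t + 4 \<noteq> 3 * k" by presburger+
  with xyz(2,3) have "x = k" "y = k" "Suc z = k"
    by (auto simp: balanced_triples_def)
  then show ?thesis using xyz(1) by auto
qed

lemma not_improvable_3k:
  assumes "\<not> improvable q (3 * k) a b c" "0 < q" "q < 1" "2 \<le> k" "a + b + c \<le> 3 * k"
  shows "{#a, b, c#} = {#k + 1, k + 1, k - 2#} \<or> {#a, b, c#} = {#k + 1, k, k - 1#}"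
proof -
  have n: "2 \<le> 3 * k" "3 * k \<noteq> 3" using assms(4) by presburger+
  obtain x y z t where xyz: "{#a, b, c#} = {#x, y, z#}" "x + y + Suc z = 3 * k + 1"
    "(x, y, Suc z) \<in> balanced_triples t"
    using not_improvable_spread[OF assms(2,3,1,5) n] .
  have "t + t + t \<noteq> 3 * k + 1" "t + t + t + 2 \<noteq> 3 * k + 1" by presburger+
  with xyz(2,3) have t: "Suc t = k"
    "(x, y, Suc z) \<in> {(t + 2, t + 2, t), (t + 2, t, t + 2), (t, t + 2, t + 2)}"
    by (auto simp: balanced_triples_def)
  have "x = k + 1 \<and> y = k + 1 \<and> z = k - 2 \<or> x = k + 1 \<and> y = k - 1 \<and> z = k \<or>
      x = k - 1 \<and> y = k + 1 \<and> z = k"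
    using t(2) unfolding t(1)[symmetric] by auto
  then show ?thesis using xyz(1) by (auto simp: add_mset_commute)
qed

lemma not_improvable_3k_plus_1:
  assumes "\<not> improvable q (3 * k + 1) a b c" "0 < q" "q < 1" "1 \<le> k" "a + b + c \<le> 3 * k + 1"
  shows "{#a, b, c#} = {#k + 1, k, k#} \<or> {#a, b, c#} = {#k + 2, k, k - 1#}"
proof -
  have n: "2 \<le> 3 * k + 1" "3 * k + 1 \<noteq> 3" using assms(4) by presburger+
  obtain x y z t where xyz: "{#a, b, c#} = {#x, y, z#}" "x + y + Suc z = 3 * k + 1 + 1"
    "(x, y, Suc z) \<in> balanced_triples t"
    using not_improvable_spread[OF assms(2,3,1,5) n] .
  have "t + t + t \<noteq> 3 * k + 2" "t + t + t + 4 \<noteq> 3 * k + 2" by presburger+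
  with xyz(2,3) have t: "t = k" "(x, y, Suc z) \<in> {(t + 2, t, t), (t, t + 2, t), (t, t, t + 2)}"
    by (auto simp: balanced_triples_def)
  have "x = k + 2 \<and> y = k \<and> z = k - 1 \<or> x = k \<and> y = k + 2 \<and> z = k - 1 \<or>
      x = k \<and> y = k \<and> z = k + 1"
    using t(2) unfolding t(1) by auto
  then show ?thesis using xyz(1) by (auto simp: add_mset_commute)
qed

lemma profile_value_3k_minus_1:
  assumes "0 < q" "q < 1" "1 \<le> k" "a + b + c \<le> 3 * k - 1" "{#a, b, c#} \<noteq> {#k, k, k - 1#}"
  shows "profile_value q a b c < profile_value q k k (k - 1)"
proof (rule value_less_if_improvable)
  show "improvable q (3 * k - 1) a b c" using not_improvable_3k_minus_1 assms by blast
  show "profile_value q a b c = profile_value q k k (k - 1)"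
    if "a + b + c \<le> 3 * k - 1" "\<not> improvable q (3 * k - 1) a b c" for a b c
    using profile_value_mset not_improvable_3k_minus_1 assms that by blast
qed

text \<open>
  Both profiles arise from the triple \<open>(k + 1, k + 1, k - 1)\<close> by decreasing one entry by 1.
\<close>

lemma profile_value_3k_eq:
  assumes "0 < q" "q < 1" "2 \<le> k"
  shows "profile_value q (k + 1) (k + 1) (k - 2) = profile_value q (k + 1) k (k - 1)"
proof -
  have k: "Suc (k - 2) = k - 1" using assms(3) by simp
  have "profile_value q (Suc k) (k - 2) (k + 1) = profile_value q k (Suc (k - 2)) (k + 1)"
    using assms by (intro transfer_eq) auto
  then show ?thesis
    unfolding k using profile_value_mset[of "k + 1" "k + 1" "k - 2" "Suc k" "k - 2" "k + 1" q]
      profile_value_mset[of "k + 1" k "k - 1" k "k - 1" "k + 1" q]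
    by (simp add: add_mset_commute)
qed

lemma profile_value_3k:
  assumes "0 < q" "q < 1" "2 \<le> k" "a + b + c \<le> 3 * k"
    "{#a, b, c#} \<noteq> {#k + 1, k + 1, k - 2#}" "{#a, b, c#} \<noteq> {#k + 1, k, k - 1#}"
  shows "profile_value q a b c < profile_value q (k + 1) k (k - 1)"
proof (rule value_less_if_improvable)
  show "improvable q (3 * k) a b c" using not_improvable_3k assms by blast
  show "profile_value q a b c = profile_value q (k + 1) k (k - 1)"
    if "a + b + c \<le> 3 * k" "\<not> improvable q (3 * k) a b c" for a b c
    using profile_value_mset not_improvable_3k[OF that(2)] profile_value_3k_eq assms(1-3) that(1) by metis
qed

text \<open>
  Both profiles arise from the triple \<open>(k + 2, k, k)\<close> by decreasing one entry by 1.
\<close>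

lemma profile_value_3k_plus_1_eq:
  assumes "0 < q" "q < 1" "1 \<le> k"
  shows "profile_value q (k + 2) k (k - 1) = profile_value q (k + 1) k k"
proof -
  have k: "Suc (k - 1) = k" using assms(3) by simp
  have "profile_value q (Suc (k + 1)) (k - 1) k = profile_value q (k + 1) (Suc (k - 1)) k"
    using assms by (intro transfer_eq) auto
  then show ?thesis
    unfolding k using profile_value_swap23[of q "k + 2" k "k - 1"] by simp
qed

lemma profile_value_3k_plus_1:
  assumes "0 < q" "q < 1" "1 \<le> k" "a + b + c \<le> 3 * k + 1"
    "{#a, b, c#} \<noteq> {#k + 1, k, k#}" "{#a, b, c#} \<noteq> {#k + 2, k, k - 1#}"
  shows "profile_value q a b c < profile_value q (k + 1) k k"
proof (rule value_less_if_improvable)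
  show "improvable q (3 * k + 1) a b c" using not_improvable_3k_plus_1 assms by blast
  show "profile_value q a b c = profile_value q (k + 1) k k"
    if "a + b + c \<le> 3 * k + 1" "\<not> improvable q (3 * k + 1) a b c" for a b c
    using profile_value_mset not_improvable_3k_plus_1[OF that(2)] profile_value_3k_plus_1_eq assms(1-3) that(1)
    by metis
qed

section \<open>Success probability of a linear code\<close>

lemma UNIV_4: "(UNIV :: 4 set) = {0, 1, 2, 3}"
proof -
  have "card {0, 1, 2, 3 :: 4} = card (UNIV :: 4 set)" by simp
  then show ?thesis by (intro card_subset_eq[symmetric]) auto
qed

lemma code_dist_eq:
  "code_dist C y = min (min (hamming_dist (row C 0) y) (hamming_dist (row C 1) y))
     (min (hamming_dist (row C 2) y) (hamming_dist (row C 3) y))"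
  by (simp add: code_dist_def UNIV_4 min.assoc)

lemma hamming_dist_Nil [simp]: "hamming_dist [] y = 0"
  by (simp add: hamming_dist_def)

lemma hamming_dist_Cons [simp]:
  "hamming_dist (x # xs) (y # ys) = of_bool (x \<noteq> y) + hamming_dist xs ys"
proof -
  have "{i. i < Suc (length xs) \<and> (x # xs) ! i \<noteq> (y # ys) ! i}
      = (if x \<noteq> y then {0} else {}) \<union> Suc ` {i. i < length xs \<and> xs ! i \<noteq> ys ! i}"
    (is "?L = ?R")
  proof (intro set_eqI)
    fix i show "i \<in> ?L \<longleftrightarrow> i \<in> ?R" by (cases i) auto
  qed
  then show ?thesis
    by (simp add: hamming_dist_def card_insert_if card_image)
qed

lemma row_simps [simp]: "row [] j = []" "row (c # C) j = c j # row C j"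
  by (simp_all add: row_def)

lemma hamming_dist_le: "hamming_dist x y \<le> length x"
  unfolding hamming_dist_def using card_mono[of "{..<length x}" "{i. i < length x \<and> x ! i \<noteq> y ! i}"]
  by auto

lemma sum_words_Suc:
  fixes g :: "bool list \<Rightarrow> real"
  shows "(\<Sum>y | length y = Suc n. g y) = (\<Sum>y | length y = n. g (False # y) + g (True # y))"
proof -
  have fin: "finite {y :: bool list. length y = n}"
    using finite_lists_length_eq[of "UNIV :: bool set" n] by simp
  have "{y :: bool list. length y = Suc n}
      = Cons False ` {y. length y = n} \<union> Cons True ` {y. length y = n}"
    by (auto simp: length_Suc_conv image_iff)
  also have "sum g \<dots> = sum g (Cons False ` {y. length y = n}) + sum g (Cons True ` {y. length y = n})"
    using fin by (intro sum.union_disjoint) auto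
  finally show ?thesis by (simp add: sum.reindex sum.distrib)
qed

lemma num_cols_simps [simp]:
  "num_cols t [] = 0" "num_cols t (c # C) = of_bool (column_type c = t) + num_cols t C"
  by (simp_all add: num_cols_def)

lemma column_bits:
  "column_type c = 0 \<Longrightarrow> \<not> c 0 \<and> \<not> c 1 \<and> \<not> c 2 \<and> \<not> c 3"
  "column_type c = 3 \<Longrightarrow> \<not> c 0 \<and> \<not> c 1 \<and> c 2 \<and> c 3"
  "column_type c = 5 \<Longrightarrow> \<not> c 0 \<and> c 1 \<and> \<not> c 2 \<and> c 3"
  "column_type c = 6 \<Longrightarrow> \<not> c 0 \<and> c 1 \<and> c 2 \<and> \<not> c 3"
  by (auto simp: column_type_def of_bool_def split: if_splits)

text \<open>
  The type of each column says which rows have bit 1 there, and all words with the same numbers of ones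
  in the columns of each type have the same distances. The function \<open>F\<close> is arbitrary so that an induction
  on the columns is possible: a new column changes \<open>F\<close> into a sum of two shifted copies.
\<close>

lemma sum_over_words:
  fixes F :: "nat \<Rightarrow> nat \<Rightarrow> nat \<Rightarrow> nat \<Rightarrow> real"
  assumes "\<forall>c\<in>set D. column_type c \<in> {0, 3, 5, 6}"
  shows "(\<Sum>y | length y = length D. F (hamming_dist (row D 0) y) (hamming_dist (row D 1) y)
      (hamming_dist (row D 2) y) (hamming_dist (row D 3) y))
    = binsum (num_cols 0 D) (\<lambda>l l'. binsum3 (num_cols 3 D) (num_cols 5 D) (num_cols 6 D)
        (\<lambda>i i' j j' k k'. F (l + (i + j + k)) (l + (i + j' + k')) (l + (i' + j + k')) (l + (i' + j' + k))))"
  using assms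
proof (induction D arbitrary: F)
  case Nil
  then show ?case by (simp add: binsum3_def)
next
  case (Cons c D)
  then have c: "column_type c = 0 \<or> column_type c = 3 \<or> column_type c = 5 \<or> column_type c = 6"
    and D: "\<forall>c\<in>set D. column_type c \<in> {0, 3, 5, 6}" by auto
  define G where "G = (\<lambda>w x y z.
    F (of_bool (c 0) + w) (of_bool (c 1) + x) (of_bool (c 2) + y) (of_bool (c 3) + z) +
    F (of_bool (\<not> c 0) + w) (of_bool (\<not> c 1) + x) (of_bool (\<not> c 2) + y) (of_bool (\<not> c 3) + z))"
  have "(\<Sum>y | length y = length (c # D). F (hamming_dist (row (c # D) 0) y)
      (hamming_dist (row (c # D) 1) y) (hamming_dist (row (c # D) 2) y) (hamming_dist (row (c # D) 3) y))
    = (\<Sum>y | length y = length D. G (hamming_dist (row D 0) y) (hamming_dist (row D 1) y)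
      (hamming_dist (row D 2) y) (hamming_dist (row D 3) y))"
    by (simp add: sum_words_Suc G_def)
  also have "\<dots> = binsum (num_cols 0 D) (\<lambda>l l'. binsum3 (num_cols 3 D) (num_cols 5 D) (num_cols 6 D)
        (\<lambda>i i' j j' k k'. G (l + (i + j + k)) (l + (i + j' + k')) (l + (i' + j + k')) (l + (i' + j' + k))))"
    by (rule Cons.IH[OF D])
  also have "\<dots> = binsum (num_cols 0 (c # D)) (\<lambda>l l'.
      binsum3 (num_cols 3 (c # D)) (num_cols 5 (c # D)) (num_cols 6 (c # D))
        (\<lambda>i i' j j' k k'. F (l + (i + j + k)) (l + (i + j' + k')) (l + (i' + j + k')) (l + (i' + j' + k))))"
    using c by (elim disjE) (simp_all add: G_def column_bits binsum3_def binsum_Suc binsum_add)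
  finally show ?case .
qed

lemma length_eq_num_cols:
  assumes "\<forall>c\<in>set D. column_type c \<in> {0, 3, 5, 6}"
  shows "length D = num_cols 0 D + num_cols 3 D + num_cols 5 D + num_cols 6 D"
  using assms by (induction D) auto

text \<open>
  The zero columns contribute the factor \<open>(1 + q) ^ num_cols 0 D\<close>, which cancels against the
  same number of factors \<open>1 - \<epsilon>\<close>.
\<close>

lemma success_prob_eq_profile_value:
  assumes D: "\<forall>c\<in>set D. column_type c \<in> {0, 3, 5, 6}" and e: "0 < \<epsilon>" "\<epsilon> < 1 / 2"
  shows "success_prob D \<epsilon> = 1 / 4 * profile_value (\<epsilon> / (1 - \<epsilon>)) (num_cols 3 D) (num_cols 5 D) (num_cols 6 D)"
proof -
  define q where "q = \<epsilon> / (1 - \<epsilon>)"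
  define m where "m = num_cols 3 D + num_cols 5 D + num_cols 6 D"
  have inv: "1 - \<epsilon> = 1 / (1 + q)" and q: "0 < q" using e by (auto simp: q_def field_simps)
  have weight: "(1 - \<epsilon>) ^ (length D - code_dist D y) * \<epsilon> ^ code_dist D y
      = (1 - \<epsilon>) ^ length D * q ^ code_dist D y" for y
  proof -
    have "code_dist D y \<le> length D"
      using hamming_dist_le[of "row D 0" y] by (simp add: code_dist_eq row_def min_le_iff_disj)
    then have "(1 - \<epsilon>) ^ length D = (1 - \<epsilon>) ^ (length D - code_dist D y) * (1 - \<epsilon>) ^ code_dist D y"
      by (simp flip: power_add)
    moreover have "\<epsilon> ^ code_dist D y = (1 - \<epsilon>) ^ code_dist D y * q ^ code_dist D y"
      using e by (simp add: q_def flip: power_mult_distrib)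
    ultimately show ?thesis by simp
  qed
  have "(\<Sum>y | length y = length D. q ^ code_dist D y) = binsum (num_cols 0 D) (\<lambda>l l'.
      binsum3 (num_cols 3 D) (num_cols 5 D) (num_cols 6 D) (\<lambda>i i' j j' k k'.
      q ^ l * q ^ nearest_dist i i' j j' k k'))"
    unfolding code_dist_eq sum_over_words[OF D, of "\<lambda>w x y z. q ^ min (min w x) (min y z)"]
    by (simp add: nearest_dist_def power_add flip: min_add_distrib_right)
  also have "\<dots> = binsum (num_cols 0 D) (\<lambda>l l'. distance_enumerator q (num_cols 3 D) (num_cols 5 D) (num_cols 6 D) * q ^ l)"
    unfolding binsum3_linear(3) distance_enumerator_def by (simp add: mult.commute)
  also have "\<dots> = distance_enumerator q (num_cols 3 D) (num_cols 5 D) (num_cols 6 D) * (1 + q) ^ num_cols 0 D"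
    by (simp only: binsum_scale binsum_power)
  finally have "success_prob D \<epsilon> = 1 / 4 * ((1 - \<epsilon>) ^ length D *
      (distance_enumerator q (num_cols 3 D) (num_cols 5 D) (num_cols 6 D) * (1 + q) ^ num_cols 0 D))"
    unfolding success_prob_def weight by (simp flip: sum_distrib_left)
  moreover have "length D = num_cols 0 D + m" using length_eq_num_cols[OF D] by (simp add: m_def)
  ultimately show ?thesis
    using q unfolding q_def[symmetric] profile_value_def m_def[symmetric] unfolding inv
    by (simp add: power_divide power_add)
qed

section \<open>Profiles and equivalence\<close>

text \<open>
  Equal multisets of columns differ by a permutation of the columns, so no flips are involved.
\<close>

lemma equivalent_codesI:
  assumes p: "bij p" and eq: "mset (map (\<lambda>c. c \<circ> p) D) = mset C"
  shows "equivalent_codes D C"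
proof -
  have len: "length D = length C" using eq by (metis length_map size_mset)
  obtain s where s: "s permutes {..<length D}" "permute_list s (map (\<lambda>c. c \<circ> p) D) = C"
    using mset_eq_permutation[OF eq[symmetric]] by auto
  have "(C ! i) j = (D ! s i) (p j)" if "i < length D" for i j
  proof -
    have "s i < length D" using s(1) that by (meson lessThan_iff permutes_in_image)
    then show ?thesis
      using that s by (metis comp_apply length_map nth_map permute_list_nth)
  qed
  then show ?thesis
    unfolding equivalent_codes_def using len p s(1) by (intro conjI exI[of _ p] exI[of _ s] exI[of _ "{}"]) auto
qed

definition profile_mset :: "nat \<Rightarrow> nat \<Rightarrow> nat \<Rightarrow> nat \<Rightarrow> column multiset" where
  "profile_mset m a b c = replicate_mset m (column_of_type 0) + replicate_mset a (column_of_type 3) +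
     replicate_mset b (column_of_type 5) + replicate_mset c (column_of_type 6)"

lemma forall_4: "(\<forall>j :: 4. P j) \<longleftrightarrow> P 0 \<and> P 1 \<and> P 2 \<and> P 3"
  using UNIV_4 by (metis UNIV_I empty_iff insert_iff)

lemma column_of_type_bits:
  "column_of_type 0 = (\<lambda>j. False)"
  "column_of_type 3 = (\<lambda>j. j = 2 \<or> j = 3)"
  "column_of_type 5 = (\<lambda>j. j = 1 \<or> j = 3)"
  "column_of_type 6 = (\<lambda>j. j = 1 \<or> j = 2)"
  by (simp_all add: fun_eq_iff forall_4 column_of_type_def bit_0)

lemma column_eq_of_type:
  assumes "column_type c \<in> {0, 3, 5, 6}"
  shows "c = column_of_type (column_type c)"
  using assms column_bits[of c] by (auto simp: fun_eq_iff forall_4 column_of_type_bits)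

lemma mset_eq_profile_mset:
  assumes "\<forall>c\<in>set D. column_type c \<in> {0, 3, 5, 6}"
  shows "mset D = profile_mset (num_cols 0 D) (num_cols 3 D) (num_cols 5 D) (num_cols 6 D)"
  using assms
proof (induction D)
  case Nil
  then show ?case by (simp add: profile_mset_def)
next
  case (Cons c D)
  then show ?case using column_eq_of_type[of c] by (auto simp: profile_mset_def)
qed

text \<open>
  Transposing rows 1 and 2 exchanges types 3 and 5 and fixes type 6; transposing rows 2 and 3
  exchanges types 5 and 6 and fixes type 3. Together they realise every permutation of the three types.
\<close>

lemma row_transpositions:
  "image_mset (\<lambda>c. c \<circ> transpose 1 2) (profile_mset m a b c) = profile_mset m b a c"
  "image_mset (\<lambda>c. c \<circ> transpose 2 3) (profile_mset m a b c) = profile_mset m a c b"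
proof -
  have "column_of_type 0 \<circ> p = column_of_type 0" for p
    by (simp add: column_of_type_bits fun_eq_iff)
  moreover have "column_of_type 3 \<circ> transpose 1 2 = column_of_type 5"
    "column_of_type 5 \<circ> transpose 1 2 = column_of_type 3"
    "column_of_type 6 \<circ> transpose 1 2 = column_of_type 6"
    "column_of_type 3 \<circ> transpose 2 3 = column_of_type 3"
    "column_of_type 5 \<circ> transpose 2 3 = column_of_type 6"
    "column_of_type 6 \<circ> transpose 2 3 = column_of_type 5"
    by (simp_all add: fun_eq_iff forall_4 column_of_type_bits transpose_def)
  ultimately show "image_mset (\<lambda>c. c \<circ> transpose 1 2) (profile_mset m a b c) = profile_mset m b a c"
    "image_mset (\<lambda>c. c \<circ> transpose 2 3) (profile_mset m a b c) = profile_mset m a c b"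
    by (simp_all add: profile_mset_def)
qed

lemma row_permutation_exists:
  assumes "{#a, b, c#} = {#x, y, z#}"
  shows "\<exists>p. bij p \<and> image_mset (\<lambda>c. c \<circ> p) (profile_mset m a b c) = profile_mset m x y z"
proof -
  define R where "R M N \<longleftrightarrow> (\<exists>p. bij p \<and> image_mset (\<lambda>c. c \<circ> p) M = N)" for M N :: "column multiset"
  have refl: "R M M" for M
    unfolding R_def by (intro exI[of _ id]) auto
  have trans: "R L N" if "R L M" "R M N" for L M N
  proof -
    obtain p where "bij p" "image_mset (\<lambda>c. c \<circ> p) L = M"
      using \<open>R L M\<close> unfolding R_def by blast
    moreover obtain p' where "bij p'" "image_mset (\<lambda>c. c \<circ> p') M = N"
      using \<open>R M N\<close> unfolding R_def by blast
    ultimately show ?thesis unfolding R_def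
      by (intro exI[of _ "p \<circ> p'"]) (auto simp: multiset.map_comp comp_def intro: bij_comp[unfolded comp_def])
  qed
  have s12: "R (profile_mset m a b c) (profile_mset m b a c)" for a b c
    unfolding R_def using row_transpositions(1) bij_swap by (metis bij_transpose)
  have s23: "R (profile_mset m a b c) (profile_mset m a c b)" for a b c
    unfolding R_def using row_transpositions(2) by (metis bij_transpose)
  have "R (profile_mset m a b c) (profile_mset m x y z)"
    using mset_triple_cases[OF assms] refl s12[of x z y] s12[of y x z] s12[of y z x] s12[of z x y] s12[of z y x]
      s23 trans by (smt (verit) Pair_inject empty_iff insert_iff)
  then show ?thesis unfolding R_def .
qed

lemma num_cols_canonical:
  "num_cols t (canonical_code a b c) = (if t = 3 then a else if t = 5 then b else if t = 6 then c else 0)"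
  by (simp add: num_cols_def canonical_code_def column_type_of_type)

text \<open>
  The lengths leave no room for zero columns.
\<close>

lemma equivalent_canonical:
  assumes D: "\<forall>c\<in>set D. column_type c \<in> {0, 3, 5, 6}" and len: "length D = x + y + z"
    and eq: "{#num_cols 3 D, num_cols 5 D, num_cols 6 D#} = {#x, y, z#}"
  shows "equivalent_codes D (canonical_code x y z)"
proof -
  have "num_cols 3 D + num_cols 5 D + num_cols 6 D = x + y + z"
    using arg_cong[OF eq, of sum_mset] by simp
  then have 0: "num_cols 0 D = 0" using length_eq_num_cols[OF D] len by simp
  obtain p where "bij p" "image_mset (\<lambda>c. c \<circ> p)
      (profile_mset 0 (num_cols 3 D) (num_cols 5 D) (num_cols 6 D)) = profile_mset 0 x y z"
    using row_permutation_exists[OF eq] by blast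
  then show ?thesis
    using mset_eq_profile_mset[OF D] 0
    by (intro equivalent_codesI[of p]) (auto simp: canonical_code_def profile_mset_def)
qed

lemma equivalent_code_A:
  assumes D: "\<forall>c\<in>set D. column_type c \<in> {0, 3, 5, 6}" and len: "length D = 3"
    and eq: "{#num_cols 3 D, num_cols 5 D, num_cols 6 D#} = {#1, 1, 0#}"
  shows "equivalent_codes D code_A"
proof -
  have "num_cols 3 D + num_cols 5 D + num_cols 6 D = 2"
    using arg_cong[OF eq, of sum_mset] by simp
  then have 1: "num_cols 0 D = 1" using length_eq_num_cols[OF D] len by simp
  obtain p where "bij p" "image_mset (\<lambda>c. c \<circ> p)
      (profile_mset 1 (num_cols 3 D) (num_cols 5 D) (num_cols 6 D)) = profile_mset 1 1 1 0"
    using row_permutation_exists[OF eq] by blast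
  then show ?thesis
    using mset_eq_profile_mset[OF D] 1
    by (intro equivalent_codesI[of p]) (auto simp: code_A_def profile_mset_def)
qed

text \<open>
  At least two of three columns are nonzero and of different types, which leaves only the profiles
  \<open>(1, 1, 0)\<close>, \<open>(1, 1, 1)\<close> and \<open>(1, 2, 0)\<close> up to order.
\<close>

lemma linear_length_3:
  assumes "linear_code D" "length D = 3"
  shows "equivalent_codes D code_A \<or> equivalent_codes D (canonical_code 1 1 1) \<or>
    equivalent_codes D (canonical_code 1 2 0)"
proof -
  have D: "\<forall>c\<in>set D. column_type c \<in> {0, 3, 5, 6}"
    and pos: "2 \<le> card {t \<in> {3, 5, 6}. 0 < num_cols t D}"
    using assms(1) by (auto simp: linear_code_def)
  define a b c where "a = num_cols 3 D" and "b = num_cols 5 D" and "c = num_cols 6 D"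
  have "{t \<in> {3, 5, 6}. 0 < num_cols t D} = (if 0 < a then {3} else {}) \<union> (if 0 < b then {5} else {})
      \<union> (if 0 < c then {6} else {})"
    by (auto simp: a_def b_def c_def)
  with pos have two: "0 < a \<and> 0 < b \<or> 0 < a \<and> 0 < c \<or> 0 < b \<and> 0 < c"
    by (auto split: if_splits)
  have le: "a + b + c \<le> 3"
    using length_eq_num_cols[OF D] assms(2) by (simp add: a_def b_def c_def)
  then have "a \<in> {0, 1, 2}" "b \<in> {0, 1, 2}" "c \<in> {0, 1, 2}" using two by auto
  then have "{#a, b, c#} = {#1, 1, 0#} \<or> {#a, b, c#} = {#1, 1, 1#} \<or> {#a, b, c#} = {#1, 2, 0#}"
    using le two by (auto simp: add_mset_commute)
  then show ?thesis
    using equivalent_code_A[OF D assms(2)] equivalent_canonical[OF D, of 1 1 1]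
      equivalent_canonical[OF D, of 1 2 0] assms(2)
    unfolding a_def b_def c_def by auto
qed

lemma canonical_better:
  assumes D: "\<forall>c\<in>set D. column_type c \<in> {0, 3, 5, 6}" and len: "length D = x + y + z"
    and less: "\<And>q. 0 < q \<Longrightarrow> q < 1 \<Longrightarrow>
      profile_value q (num_cols 3 D) (num_cols 5 D) (num_cols 6 D) < profile_value q x y z"
  shows "univ_strictly_better (canonical_code x y z) D"
proof -
  have C: "\<forall>c\<in>set (canonical_code x y z). column_type c \<in> {0, 3, 5, 6}"
    by (auto simp: canonical_code_def column_type_of_type)
  have "success_prob D \<epsilon> < success_prob (canonical_code x y z) \<epsilon>" if e: "0 < \<epsilon>" "\<epsilon> < 1 / 2" for \<epsilon>
    using less[of "\<epsilon> / (1 - \<epsilon>)"] e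
    by (simp add: success_prob_eq_profile_value[OF D e] success_prob_eq_profile_value[OF C e] num_cols_canonical)
  then show ?thesis using len by (simp add: univ_strictly_better_def length_canonical_code)
qed

section \<open>Optimal linear codes\<close>

theorem theorem2:
  shows
    "(\<forall>k\<ge>1. \<forall>D. linear_code D \<and> length D = 3 * k - 1 \<and>
        \<not> equivalent_codes D (canonical_code k k (k - 1)) \<longrightarrow>
        univ_strictly_better (canonical_code k k (k - 1)) D)
     \<and>
     (\<forall>D. linear_code D \<and> length D = 3 \<and>
        \<not> equivalent_codes D code_A \<and>
        \<not> equivalent_codes D (canonical_code 1 1 1) \<and>
        \<not> equivalent_codes D (canonical_code 1 2 0) \<longrightarrow>
        univ_strictly_better code_A D \<and>
        univ_strictly_better (canonical_code 1 1 1) D \<and>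
        univ_strictly_better (canonical_code 1 2 0) D)
     \<and>
     (\<forall>k\<ge>2. \<forall>D. linear_code D \<and> length D = 3 * k \<and>
        \<not> equivalent_codes D (canonical_code (k + 1) (k + 1) (k - 2)) \<and>
        \<not> equivalent_codes D (canonical_code (k + 1) k (k - 1)) \<longrightarrow>
        univ_strictly_better (canonical_code (k + 1) (k + 1) (k - 2)) D \<and>
        univ_strictly_better (canonical_code (k + 1) k (k - 1)) D)
     \<and>
     (\<forall>k\<ge>1. \<forall>D. linear_code D \<and> length D = 3 * k + 1 \<and>
        \<not> equivalent_codes D (canonical_code (k + 1) k k) \<and>
        \<not> equivalent_codes D (canonical_code (k + 2) k (k - 1)) \<longrightarrow>
        univ_strictly_better (canonical_code (k + 1) k k) D \<and>
        univ_strictly_better (canonical_code (k + 2) k (k - 1)) D)"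
proof (intro conjI allI impI)
  fix k D
  assume k: "1 \<le> k" and D: "linear_code D \<and> length D = 3 * k - 1 \<and>
    \<not> equivalent_codes D (canonical_code k k (k - 1))"
  have types: "\<forall>c\<in>set D. column_type c \<in> {0, 3, 5, 6}" using D by (simp add: linear_code_def)
  have len: "length D = k + k + (k - 1)" using D k by simp
  have ne: "{#num_cols 3 D, num_cols 5 D, num_cols 6 D#} \<noteq> {#k, k, k - 1#}"
    using equivalent_canonical[OF types len] D by blast
  have le: "num_cols 3 D + num_cols 5 D + num_cols 6 D \<le> 3 * k - 1"
    using length_eq_num_cols[OF types] D by simp
  show "univ_strictly_better (canonical_code k k (k - 1)) D"
    by (intro canonical_better[OF types len] profile_value_3k_minus_1 k le ne)
next
  fix D
  assume D: "linear_code D \<and> length D = 3 \<and> \<not> equivalent_codes D code_A \<and>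
    \<not> equivalent_codes D (canonical_code 1 1 1) \<and> \<not> equivalent_codes D (canonical_code 1 2 0)"
  then have False using linear_length_3 by blast
  then show "univ_strictly_better code_A D" "univ_strictly_better (canonical_code 1 1 1) D"
    "univ_strictly_better (canonical_code 1 2 0) D" by blast+
next
  fix k D
  assume k: "2 \<le> k" and D: "linear_code D \<and> length D = 3 * k \<and>
    \<not> equivalent_codes D (canonical_code (k + 1) (k + 1) (k - 2)) \<and>
    \<not> equivalent_codes D (canonical_code (k + 1) k (k - 1))"
  have types: "\<forall>c\<in>set D. column_type c \<in> {0, 3, 5, 6}" using D by (simp add: linear_code_def)
  have len: "length D = (k + 1) + (k + 1) + (k - 2)" "length D = (k + 1) + k + (k - 1)"
    using D k by auto
  have ne: "{#num_cols 3 D, num_cols 5 D, num_cols 6 D#} \<noteq> {#k + 1, k + 1, k - 2#}"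
    "{#num_cols 3 D, num_cols 5 D, num_cols 6 D#} \<noteq> {#k + 1, k, k - 1#}"
    using equivalent_canonical[OF types len(1)] equivalent_canonical[OF types len(2)] D by blast+
  have le: "num_cols 3 D + num_cols 5 D + num_cols 6 D \<le> 3 * k"
    using length_eq_num_cols[OF types] D by simp
  note less = profile_value_3k[OF _ _ k le ne]
  show "univ_strictly_better (canonical_code (k + 1) (k + 1) (k - 2)) D"
    by (intro canonical_better[OF types len(1)]) (simp only: profile_value_3k_eq k less)
  show "univ_strictly_better (canonical_code (k + 1) k (k - 1)) D"
    by (intro canonical_better[OF types len(2)] less)
next
  fix k D
  assume k: "1 \<le> k" and D: "linear_code D \<and> length D = 3 * k + 1 \<and>
    \<not> equivalent_codes D (canonical_code (k + 1) k k) \<and>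
    \<not> equivalent_codes D (canonical_code (k + 2) k (k - 1))"
  have types: "\<forall>c\<in>set D. column_type c \<in> {0, 3, 5, 6}" using D by (simp add: linear_code_def)
  have len: "length D = (k + 1) + k + k" "length D = (k + 2) + k + (k - 1)"
    using D k by auto
  have ne: "{#num_cols 3 D, num_cols 5 D, num_cols 6 D#} \<noteq> {#k + 1, k, k#}"
    "{#num_cols 3 D, num_cols 5 D, num_cols 6 D#} \<noteq> {#k + 2, k, k - 1#}"
    using equivalent_canonical[OF types len(1)] equivalent_canonical[OF types len(2)] D by blast+
  have le: "num_cols 3 D + num_cols 5 D + num_cols 6 D \<le> 3 * k + 1"
    using length_eq_num_cols[OF types] D by simp
  note less = profile_value_3k_plus_1[OF _ _ k le ne]
  show "univ_strictly_better (canonical_code (k + 1) k k) D"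
    by (intro canonical_better[OF types len(1)] less)
  show "univ_strictly_better (canonical_code (k + 2) k (k - 1)) D"
    by (intro canonical_better[OF types len(2)]) (simp only: profile_value_3k_plus_1_eq k less)
qed

end
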